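(* Let $m\ge 4$ and $n\ge 5$ be integers. Consider the king-and-rook versus king endgame on an $m\times n$ board in the starting position: White king on $(m,1)$, White rook on $(1,1)$, Black king on $(m,n)$, with White to move. Let $FM(m,n)$ be the smallest number of White moves within which White can force checkmate. Then $$FM(m,n)=\begin{cases} n & \text{if } n \text{ is odd},\\ n+1 & \text{if } n \text{ is even}.\end{cases}$$
   Context: The board is the set of squares $(x,y)$ with $1\le x\le m$ (column) and $1\le y\le n$ (row). The pieces move and capture as in ordinary chess, restricted to this rectangular board: a king moves to any of the up to eight adjacent squares (including diagonally adjacent ones), and a rook moves any number of squares along its row or column without passing through another piece. The usual legality rules apply: a king may not move to a square attacked by an enemy piece, and the two kings may never be on adjacent squares. Black is checkmated if the Black king is attacked and Black has no legal move. White can force checkmate within $k$ moves if White has a strategy such that, against every sequence of legal Black replies, Black is checkmated by one of White's first $k$ moves. White moves first and the players alternate. *)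

theory Defs
  imports Main
begin

text \<open>Squares are pairs (x,y) of integers: x = column, y = row.
  A position is (White king, White rook (None if it has been captured), Black king).
  The side to move is implicit in which move function is applied.\<close>

type_synonym square = "int \<times> int"
type_synonym pos = "square \<times> square option \<times> square"

definition on_board :: "nat \<Rightarrow> nat \<Rightarrow> square \<Rightarrow> bool" where
  "on_board m n s \<longleftrightarrow> 1 \<le> fst s \<and> fst s \<le> int m \<and> 1 \<le> snd s \<and> snd s \<le> int n"

definition adj :: "square \<Rightarrow> square \<Rightarrow> bool" where
  "adj p q \<longleftrightarrow> p \<noteq> q \<and> \<bar>fst p - fst q\<bar> \<le> 1 \<and> \<bar>snd p - snd q\<bar> \<le> 1"

definition strictly_between :: "square \<Rightarrow> square \<Rightarrow> square \<Rightarrow> bool" where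
  "strictly_between r t s \<longleftrightarrow>
     (fst r = fst t \<and> fst s = fst r \<and> min (snd r) (snd t) < snd s \<and> snd s < max (snd r) (snd t)) \<or>
     (snd r = snd t \<and> snd s = snd r \<and> min (fst r) (fst t) < fst s \<and> fst s < max (fst r) (fst t))"

definition rook_attacks :: "square \<Rightarrow> square set \<Rightarrow> square \<Rightarrow> bool" where
  "rook_attacks r B t \<longleftrightarrow> r \<noteq> t \<and> (fst r = fst t \<or> snd r = snd t) \<and>
     (\<forall>s. strictly_between r t s \<longrightarrow> s \<notin> B)"

definition white_moves :: "nat \<Rightarrow> nat \<Rightarrow> pos \<Rightarrow> pos set" where
  "white_moves m n p = (case p of (wk, wr, bk) \<Rightarrow>
     {(wk', wr, bk) | wk'. on_board m n wk' \<and> adj wk wk' \<and> wr \<noteq> Some wk' \<and>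
                           wk' \<noteq> bk \<and> \<not> adj wk' bk}
     \<union> {(wk, Some r', bk) | r r'. wr = Some r \<and> on_board m n r' \<and>
                           rook_attacks r {wk, bk} r' \<and> r' \<noteq> wk \<and> r' \<noteq> bk})"

text \<open>Legal Black (king) moves, possibly capturing the rook. A destination is
  attacked by the rook if the rook reaches it with only the White king as blocker
  (the Black king has left its square).\<close>
definition black_moves :: "nat \<Rightarrow> nat \<Rightarrow> pos \<Rightarrow> pos set" where
  "black_moves m n p = (case p of (wk, wr, bk) \<Rightarrow>
     {(wk, wr', bk') | wr' bk'. on_board m n bk' \<and> adj bk bk' \<and> bk' \<noteq> wk \<and> \<not> adj bk' wk \<and>
        (case wr of None \<Rightarrow> wr' = None
         | Some r \<Rightarrow> (if bk' = r then wr' = None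
                     else wr' = Some r \<and> \<not> rook_attacks r {wk} bk'))})"

definition black_in_check :: "pos \<Rightarrow> bool" where
  "black_in_check p = (case p of (wk, wr, bk) \<Rightarrow>
     (case wr of None \<Rightarrow> False | Some r \<Rightarrow> rook_attacks r {wk} bk))"

definition checkmated :: "nat \<Rightarrow> nat \<Rightarrow> pos \<Rightarrow> bool" where
  "checkmated m n p \<longleftrightarrow> black_in_check p \<and> black_moves m n p = {}"

fun mate_within :: "nat \<Rightarrow> nat \<Rightarrow> nat \<Rightarrow> pos \<Rightarrow> bool" where
  "mate_within m n 0 p = False"
| "mate_within m n (Suc k) p =
     (\<exists>p' \<in> white_moves m n p. checkmated m n p' \<or>
        (black_moves m n p' \<noteq> {} \<and> (\<forall>p'' \<in> black_moves m n p'. mate_within m n k p'')))"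

definition start_pos :: "nat \<Rightarrow> nat \<Rightarrow> pos" where
  "start_pos m n = ((int m, 1), Some (1, 1), (int m, int n))"

definition FM :: "nat \<Rightarrow> nat \<Rightarrow> nat" where
  "FM m n = (LEAST k. mate_within m n k (start_pos m n))"

end

(*
  Upper bound.  The rook goes to column m - 1, next to the White king, and confines the Black king to
  column m.  With White to move and an odd distance in rows, the White king walks up column m, the
  Black king can only shuttle, and it is mated in the corner.  For even n a rook move along column
  m - 1 first changes the parity.

  Lower bound.  While the Black king stays in the top rows, the White king needs n - 3 moves to reach
  the third row from the top, so in the allotted time White can afford at most two moves, besides the
  mating move, that do not advance the king.  There is an explicit family of positions, graded by the
  number k of moves left, that is closed under play: after every White move Black is not mated and,
  unless stalemated, can take the rook or reply into the family for k - 1.  Each closure condition is a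
  statement of linear integer arithmetic about the coordinates of the three pieces and of the edges.
*)

theory Submission
  imports Defs
begin

section \<open>Coordinates\<close>

text \<open>Rows are counted downwards from the top row \<open>n\<close>, which gets index 0: the square in column
  \<open>c\<close> with row index \<open>y\<close> is \<open>(c, n - y)\<close>.  Throughout, \<open>(wx, i)\<close>, \<open>(rx, j)\<close> and \<open>(c, y)\<close> stand for the
  White king, the rook and the Black king.\<close>

definition near :: "int \<Rightarrow> int \<Rightarrow> int \<Rightarrow> bool" where
  "near a b d \<longleftrightarrow> a - b \<le> d \<and> b - a \<le> d"

definition in_box :: "int \<Rightarrow> int \<Rightarrow> int \<Rightarrow> int \<Rightarrow> int \<Rightarrow> bool" where
  "in_box a b c y d \<longleftrightarrow> near a c d \<and> near b y d"

definition betw :: "int \<Rightarrow> int \<Rightarrow> int \<Rightarrow> bool" where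
  "betw a b c \<longleftrightarrow> a < c \<and> c < b \<or> b < c \<and> c < a"

definition att :: "int \<Rightarrow> int \<Rightarrow> int \<Rightarrow> int \<Rightarrow> int \<Rightarrow> int \<Rightarrow> bool" where
  "att rx j wx i c y \<longleftrightarrow> \<not> (rx = c \<and> j = y) \<and>
    (rx = c \<and> \<not> (wx = rx \<and> betw j y i) \<or> j = y \<and> \<not> (i = j \<and> betw rx c wx))"

definition board :: "int \<Rightarrow> int \<Rightarrow> int \<Rightarrow> int \<Rightarrow> bool" where
  "board m n c y \<longleftrightarrow> 1 \<le> c \<and> c \<le> m \<and> 0 \<le> y \<and> y \<le> n - 1"

definition placed :: "int \<Rightarrow> int \<Rightarrow> int \<Rightarrow> int \<Rightarrow> int \<Rightarrow> int \<Rightarrow> int \<Rightarrow> int \<Rightarrow> bool" where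
  "placed m n wx i rx j c y \<longleftrightarrow> board m n wx i \<and> board m n rx j \<and> board m n c y \<and>
     \<not> in_box wx i c y 1 \<and> \<not> (wx = rx \<and> i = j) \<and> \<not> (rx = c \<and> j = y)"

text \<open>Only the destination of the Black king enters: the sole blocker in \<open>att\<close> is
  the White king, so the rook also sees through the square that the Black king leaves.\<close>

definition reply :: "int \<Rightarrow> int \<Rightarrow> int \<Rightarrow> int \<Rightarrow> int \<Rightarrow> int \<Rightarrow> int \<Rightarrow> int \<Rightarrow> bool" where
  "reply m n wx i rx j a b \<longleftrightarrow>
     board m n a b \<and> \<not> in_box a b wx i 1 \<and> \<not> (a = rx \<and> b = j) \<and> \<not> att rx j wx i a b"

definition takes :: "int \<Rightarrow> int \<Rightarrow> int \<Rightarrow> int \<Rightarrow> int \<Rightarrow> int \<Rightarrow> bool" where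
  "takes wx i rx j a b \<longleftrightarrow> a = rx \<and> b = j \<and> \<not> in_box a b wx i 1"

text \<open>The eight king steps are spelled out so that the closure conditions become
  quantifier-free; \<open>go_iff\<close> recovers the existential form.\<close>

definition go :: "(int \<Rightarrow> int \<Rightarrow> bool) \<Rightarrow> int \<Rightarrow> int \<Rightarrow> bool" where
  "go P c y \<longleftrightarrow> P (c - 1) (y - 1) \<or> P (c - 1) y \<or> P (c - 1) (y + 1) \<or> P c (y - 1) \<or> P c (y + 1) \<or>
     P (c + 1) (y - 1) \<or> P (c + 1) y \<or> P (c + 1) (y + 1)"

definition pos_at :: "nat \<Rightarrow> int \<Rightarrow> int \<Rightarrow> int \<Rightarrow> int \<Rightarrow> int \<Rightarrow> int \<Rightarrow> pos" where
  "pos_at n wx i rx j c y = ((wx, int n - i), Some (rx, int n - j), (c, int n - y))"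

lemma go_iff: "go P c y \<longleftrightarrow> (\<exists>a b. in_box a b c y 1 \<and> \<not> (a = c \<and> b = y) \<and> P a b)" (is "?L \<longleftrightarrow> ?R")
proof
  assume L: ?L
  have *: "P a b \<Longrightarrow> in_box a b c y 1 \<Longrightarrow> \<not> (a = c \<and> b = y) \<Longrightarrow> ?R" for a b by blast
  from L [unfolded go_def] show ?R
  proof (elim disjE)
  qed (erule *; simp add: in_box_def near_def)+
next
  assume ?R
  then obtain a b where ab: "in_box a b c y 1" "\<not> (a = c \<and> b = y)" "P a b" by blast
  then have "(a = c - 1 \<or> a = c \<or> a = c + 1) \<and> (b = y - 1 \<or> b = y \<or> b = y + 1)"
    by (auto simp: in_box_def near_def)
  with ab show ?L unfolding go_def by auto
qed

section \<open>Translation of the rules of play into arithmetic\<close>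

lemma rook_attacks_att:
  "rook_attacks (rx, n - j) {(wx, n - i)} (c, n - y) \<longleftrightarrow> att rx j wx i c y"
proof -
  have single: "(\<forall>s. strictly_between p q s \<longrightarrow> s \<notin> {w}) \<longleftrightarrow> \<not> strictly_between p q w" for p q w
    by blast
  show ?thesis
    unfolding rook_attacks_def single unfolding strictly_between_def att_def betw_def by auto
qed

lemma adj_iff: "adj (a, n - b) (c, n - y) \<longleftrightarrow> in_box a b c y 1 \<and> \<not> (a = c \<and> b = y)"
  unfolding adj_def in_box_def near_def by auto

lemma on_board_iff: "on_board m n (a, int n - b) \<longleftrightarrow> board (int m) (int n) a b"
  unfolding on_board_def board_def by auto

lemma row_index: obtains a b where "(s :: square) = (a, int n - b)"
  by (rule that [of "fst s" "int n - snd s"]) simp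

text \<open>The rook case keeps the alignment of the two squares and forgets that the path must be
  free. White thus gets at least the legal moves, which is safe because the lower bound defends
  against all of them.\<close>

lemma white_moves_cases:
  assumes "p' \<in> white_moves m n (pos_at n wx i rx j c y)" "placed (int m) (int n) wx i rx j c y"
  obtains (king) vx vi where "p' = pos_at n vx vi rx j c y" "in_box wx i vx vi 1"
      "placed (int m) (int n) vx vi rx j c y" "\<not> (wx = vx \<and> i = vi)"
    | (rook) sx sj where "p' = pos_at n wx i sx sj c y" "rx = sx \<or> j = sj" "\<not> (rx = sx \<and> j = sj)"
      "placed (int m) (int n) wx i sx sj c y"
proof -
  from assms(1) consider
    (K) wk where "p' = (wk, Some (rx, int n - j), (c, int n - y))" "on_board m n wk" "adj (wx, int n - i) wk"
      "wk \<noteq> (rx, int n - j)" "wk \<noteq> (c, int n - y)" "\<not> adj wk (c, int n - y)"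
    | (R) r where "p' = ((wx, int n - i), Some r, (c, int n - y))" "on_board m n r"
      "rook_attacks (rx, int n - j) {(wx, int n - i), (c, int n - y)} r" "r \<noteq> (wx, int n - i)" "r \<noteq> (c, int n - y)"
    by (auto simp: white_moves_def pos_at_def)
  then show thesis
  proof cases
    case K
    obtain a b where wk: "wk = (a, int n - b)" by (rule row_index)
    have "\<not> (a = rx \<and> b = j)" "\<not> (a = c \<and> b = y)" using K(4,5) by (auto simp: wk)
    moreover have "in_box wx i a b 1" "\<not> (wx = a \<and> i = b)" "board (int m) (int n) a b"
      using K(2,3) by (simp_all add: wk adj_iff on_board_iff)
    moreover have "\<not> in_box a b c y 1" using K(6) \<open>\<not> (a = c \<and> b = y)\<close> by (simp add: wk adj_iff)
    ultimately show thesis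
      using K(1) assms(2) by (intro king [of a b]) (auto simp: wk pos_at_def placed_def)
  next
    case R
    obtain a b where r: "r = (a, int n - b)" by (rule row_index)
    have "rx = a \<or> j = b" "\<not> (rx = a \<and> j = b)" using R(3) by (auto simp: r rook_attacks_def)
    moreover have "board (int m) (int n) a b" using R(2) by (simp add: r on_board_iff)
    moreover have "\<not> (wx = a \<and> i = b)" "\<not> (a = c \<and> b = y)" using R(4,5) by (auto simp: r)
    ultimately show thesis
      using R(1) assms(2) by (intro rook [of a b]) (auto simp: r pos_at_def placed_def)
  qed
qed

lemma white_king_move:
  assumes "in_box wx i vx vi 1" "\<not> (wx = vx \<and> i = vi)" "placed (int m) (int n) vx vi rx j c y"
  shows "pos_at n vx vi rx j c y \<in> white_moves m n (pos_at n wx i rx j c y)"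
  using assms unfolding white_moves_def pos_at_def placed_def
  by (auto simp: on_board_iff adj_iff in_box_def near_def)

lemma black_moves_cases:
  assumes "p'' \<in> black_moves m n (pos_at n wx i rx j c y)"
  obtains (capture) a b where "fst (snd p'') = None" "in_box a b c y 1" "\<not> (a = c \<and> b = y)" "takes wx i rx j a b"
    | (step) a b where "p'' = pos_at n wx i rx j a b" "in_box a b c y 1" "\<not> (a = c \<and> b = y)"
      "reply (int m) (int n) wx i rx j a b"
proof -
  from assms obtain wr s where s: "p'' = ((wx, int n - i), wr, s)" "on_board m n s" "adj (c, int n - y) s"
    "s \<noteq> (wx, int n - i)" "\<not> adj s (wx, int n - i)"
    "if s = (rx, int n - j) then wr = None
     else wr = Some (rx, int n - j) \<and> \<not> rook_attacks (rx, int n - j) {(wx, int n - i)} s"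
    by (auto simp: black_moves_def pos_at_def)
  obtain a b where s_eq: "s = (a, int n - b)" by (rule row_index)
  have near_ab: "in_box a b c y 1" "\<not> (a = c \<and> b = y)"
    using s(3) unfolding s_eq adj_iff by (auto simp: in_box_def near_def)
  have far: "\<not> in_box a b wx i 1"
    using s(4,5) unfolding s_eq adj_iff by auto
  show thesis
  proof (cases "a = rx \<and> b = j")
    case True
    then show thesis
      using capture [OF _ near_ab] s(1,6) far by (simp add: s_eq takes_def)
  next
    case False
    then show thesis
      using step [OF _ near_ab] s(1,2,6) far
      by (auto simp: s_eq pos_at_def reply_def on_board_iff rook_attacks_att)
  qed
qed

lemma black_step:
  assumes "reply (int m) (int n) wx i rx j a b" "in_box a b c y 1" "\<not> (a = c \<and> b = y)"
  shows "pos_at n wx i rx j a b \<in> black_moves m n (pos_at n wx i rx j c y)"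
  using assms unfolding black_moves_def pos_at_def reply_def
  by (auto simp: on_board_iff adj_iff rook_attacks_att in_box_def near_def)

lemma black_capture:
  assumes "takes wx i rx j a b" "board (int m) (int n) a b" "in_box a b c y 1" "\<not> (a = c \<and> b = y)"
  shows "((wx, int n - i), None, (a, int n - b)) \<in> black_moves m n (pos_at n wx i rx j c y)"
  using assms unfolding black_moves_def pos_at_def takes_def
  by (auto simp: on_board_iff adj_iff in_box_def near_def)

lemma black_in_check_iff: "black_in_check (pos_at n wx i rx j c y) \<longleftrightarrow> att rx j wx i c y"
  by (simp add: black_in_check_def pos_at_def rook_attacks_att)

section \<open>Positions that Black can hold\<close>

definition inside :: "int \<Rightarrow> int \<Rightarrow> int \<Rightarrow> int \<Rightarrow> bool" where
  "inside m n c y \<longleftrightarrow> 1 < c \<and> c < m \<and> 0 < y \<and> y < n - 1"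

definition corner :: "int \<Rightarrow> int \<Rightarrow> int \<Rightarrow> int \<Rightarrow> bool" where
  "corner m n c y \<longleftrightarrow> (c = 1 \<or> c = m) \<and> (y = 0 \<or> y = n - 1)"

text \<open>For the Black king on an edge: \<open>e\<close> is the distance of the White king from that edge, \<open>d\<close> and \<open>rd\<close>
  are the offsets of the White king and of the rook from the Black king along the edge, \<open>re\<close> is the
  distance of the rook from the edge, and \<open>lo\<close>, \<open>hi\<close> say that the Black king is next to a corner.\<close>

definition edge1 :: "int \<Rightarrow> int \<Rightarrow> int \<Rightarrow> bool" where
  "edge1 e d rd \<longleftrightarrow> (e = 2 \<longrightarrow> d = 0 \<longrightarrow> near rd 0 1)"

definition edge2 :: "int \<Rightarrow> int \<Rightarrow> int \<Rightarrow> int \<Rightarrow> bool \<Rightarrow> bool \<Rightarrow> bool" where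
  "edge2 e d rd re lo hi \<longleftrightarrow> e = 0 \<or> e \<ge> 4 \<or>
     e = 1 \<and> ((d \<ge> 2 \<longrightarrow> rd \<noteq> - 1) \<and> (d \<le> - 2 \<longrightarrow> rd \<noteq> 1) \<or> re = 1 \<and> \<not> near d 0 2) \<or>
     e = 2 \<and> (d \<ge> 2 \<and> rd = 1 \<or> d \<le> - 2 \<and> rd = - 1 \<or>
        re = 1 \<and> d \<noteq> 0 \<and> (d = 1 \<longrightarrow> rd \<noteq> - 1 \<and> (rd = 1 \<longrightarrow> \<not> lo)) \<and>
          (d = - 1 \<longrightarrow> rd \<noteq> 1 \<and> (rd = - 1 \<longrightarrow> \<not> hi))) \<or>
     e = 3 \<and> (rd = 1 \<longrightarrow> d \<ge> 2 \<or> d \<le> - 3) \<and> (rd = - 1 \<longrightarrow> d \<le> - 2 \<or> d \<ge> 3)"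

definition inner :: "int \<Rightarrow> int \<Rightarrow> bool" where
  "inner m c \<longleftrightarrow> 1 < c \<and> c < m"

definition rim :: "int \<Rightarrow> int \<Rightarrow> bool" where
  "rim m c \<longleftrightarrow> c = 1 \<or> c = m"

text \<open>On the side away from the rook, at least \<open>d\<close> columns lie beyond the Black
  king.\<close>

definition room :: "int \<Rightarrow> int \<Rightarrow> int \<Rightarrow> int \<Rightarrow> bool" where
  "room m d rx c \<longleftrightarrow> (rx < c \<longrightarrow> c \<le> m - d) \<and> (rx > c \<longrightarrow> d < c)"

text \<open>Excludes a rook that shuts the Black king into the two outermost columns while the king
  stands in the inner one of them.\<close>

definition uncut :: "int \<Rightarrow> int \<Rightarrow> int \<Rightarrow> bool" where
  "uncut m rx c \<longleftrightarrow> (c = m - 1 \<longrightarrow> rx \<noteq> c - 1) \<and> (c = 2 \<longrightarrow> rx \<noteq> c + 1)"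

definition fenced :: "int \<Rightarrow> int \<Rightarrow> int \<Rightarrow> bool" where
  "fenced m rx c \<longleftrightarrow> c = 1 \<and> rx = 2 \<or> c = m \<and> rx = m - 1"

text \<open>\<open>Top\<close>, \<open>Second\<close>, \<open>Third\<close>, \<open>Fourth\<close>
  name the row of a Black king off the side columns, \<open>Side\<close> a Black king in a side
  column. In \<open>Cut5\<close> to \<open>Cut2\<close> the rook on row index 1 holds the Black king
  to the top row. The digit in \<open>Corner\<close> and \<open>Edge\<close> is \<open>k\<close>;
  elsewhere the first digit is \<open>i\<close> and a second one is \<open>y\<close>. The shapes
  ending in \<open>_far\<close> have \<open>k = i + 1\<close> and an even row distance between the
  kings. \<open>Side_opp\<close> is the ladder position of the upper bound, but with the parity that
  is wrong for White.\<close>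

datatype shape = Start | Inside | Corner1 | Edge1 | Edge2 | Corner2
  | Top | Top_far | Top_six | Cut5 | Cut4 | Cut3
  | Cut3_wide | Cut2 | Top_box | Second | Second_far | Second4a
  | Second4b | Second3a | Second3b | Fourth | Third | Third_far
  | Third_cut | Side | Side41 | Side41_open | Side31a | Side31b
  | Side32 | Side_opp | Side40

text \<open>\<open>holds s e m n k \<dots>\<close>, with \<open>e\<close> the parity \<open>even i\<close>, describes positions with White to move in which
  White has no mate within \<open>k\<close> moves.  The White king must come up to row index 2, so with \<open>k \<le> i - 1\<close>,
  \<open>k = i\<close> and \<open>k = i + 1\<close> White can afford no, one and two moves (besides the mating move) that do not
  advance the king.  The shapes and their side conditions were read off from the exact distances to
  mate on small boards.  On squares off the edges, \<open>Edge1\<close> and \<open>Edge2\<close> hold vacuously.\<close>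

primrec holds :: "shape \<Rightarrow> bool \<Rightarrow> int \<Rightarrow> int \<Rightarrow> int \<Rightarrow> int \<Rightarrow> int \<Rightarrow> int \<Rightarrow> int \<Rightarrow> int \<Rightarrow> int \<Rightarrow> bool" where
  "holds Start e m n k wx i rx j c y \<longleftrightarrow> (e \<and> k = n - 1 \<or> \<not> e \<and> k = n) \<and>
     wx = m \<and> i = n - 1 \<and> rx = 1 \<and> j = n - 1 \<and> c = m \<and> y = 0"
| "holds Inside e m n k wx i rx j c y \<longleftrightarrow> k \<le> 3 \<and> inside m n c y"
| "holds Corner1 e m n k wx i rx j c y \<longleftrightarrow> k = 1 \<and> corner m n c y \<and>
     (\<not> in_box wx i c y 2 \<or> (wx - c = 2 \<or> wx - c = - 2) \<and> (i - y = 2 \<or> i - y = - 2))"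
| "holds Edge1 e m n k wx i rx j c y \<longleftrightarrow> k = 1 \<and> \<not> corner m n c y \<and>
     (y = 0 \<longrightarrow> edge1 i (wx - c) (rx - c)) \<and>
     (y = n - 1 \<longrightarrow> edge1 (n - 1 - i) (wx - c) (rx - c)) \<and>
     (c = 1 \<longrightarrow> edge1 (wx - 1) (i - y) (j - y)) \<and>
     (c = m \<longrightarrow> edge1 (m - wx) (i - y) (j - y))"
| "holds Edge2 e m n k wx i rx j c y \<longleftrightarrow> k = 2 \<and> \<not> corner m n c y \<and>
     (y = 0 \<longrightarrow> edge2 i (wx - c) (rx - c) j (c = 2) (c = m - 1)) \<and>
     (y = n - 1 \<longrightarrow> edge2 (n - 1 - i) (wx - c) (rx - c) (n - 1 - j) (c = 2) (c = m - 1)) \<and>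
     (c = 1 \<longrightarrow> edge2 (wx - 1) (i - y) (j - y) (rx - 1) (y = 1) (y = n - 2)) \<and>
     (c = m \<longrightarrow> edge2 (m - wx) (i - y) (j - y) (m - rx) (y = 1) (y = n - 2))"
| "holds Corner2 e m n k wx i rx j c y \<longleftrightarrow> k = 2 \<and> corner m n c y \<and> y = 0 \<and>
     ((wx - c = 2 \<or> wx - c = - 2) \<and> i = 2 \<and> j = 2 \<and> near rx c 1 \<or>
      i = 3 \<and> near wx c 2 \<and> near rx c 2 \<and> (rx \<noteq> wx \<or> j \<le> 2) \<or>
      i \<le> 2 \<and> \<not> near wx c 2 \<and> j \<le> 2 \<and> (j \<noteq> i \<or> near rx c 2))"
| "holds Top e m n k wx i rx j c y \<longleftrightarrow> 2 \<le> k \<and> inner m c \<and> y = 0 \<and> i \<ge> 4 \<and> k \<le> i \<and> e"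
| "holds Top_far e m n k wx i rx j c y \<longleftrightarrow> inner m c \<and> y = 0 \<and> i \<ge> 6 \<and> k = i + 1 \<and> e"
| "holds Top_six e m n k wx i rx j c y \<longleftrightarrow> 2 \<le> k \<and> inner m c \<and> y = 0 \<and> i = 4 \<and> k \<le> 5 \<and>
     c = m - 1 \<and> rx = 1 \<and> j = 5 \<and> wx \<ge> c"
| "holds Cut5 e m n k wx i rx j c y \<longleftrightarrow> 2 \<le> k \<and> inner m c \<and> y = 0 \<and> j = 1 \<and> i \<ge> 5 \<and> k \<le> i + 1"
| "holds Cut4 e m n k wx i rx j c y \<longleftrightarrow> 2 \<le> k \<and> inner m c \<and> y = 0 \<and> j = 1 \<and> i = 4 \<and> k \<le> 5 \<and> room m 2 rx c"
| "holds Cut3 e m n k wx i rx j c y \<longleftrightarrow> 2 \<le> k \<and> inner m c \<and> y = 0 \<and> j = 1 \<and> i = 3 \<and> k \<le> 3 \<and> room m 2 rx c"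
| "holds Cut3_wide e m n k wx i rx j c y \<longleftrightarrow> 2 \<le> k \<and> inner m c \<and> y = 0 \<and> j = 1 \<and> i = 3 \<and> k \<le> 4 \<and> room m 3 rx c"
| "holds Cut2 e m n k wx i rx j c y \<longleftrightarrow> 2 \<le> k \<and> inner m c \<and> y = 0 \<and> j = 1 \<and> i = 2 \<and> k \<le> 3 \<and> room m 2 rx c \<and>
     wx \<noteq> c \<and> (wx = c + 1 \<longrightarrow> rx \<noteq> c - 1 \<and> (rx = c + 1 \<longrightarrow> c \<ge> 3)) \<and>
     (wx = c - 1 \<longrightarrow> rx \<noteq> c + 1 \<and> (rx = c - 1 \<longrightarrow> c \<le> m - 2))"
| "holds Top_box e m n k wx i rx j c y \<longleftrightarrow> 2 \<le> k \<and> inner m c \<and> y = 0 \<and> (i = 2 \<or> i = 3) \<and> k \<le> 3 \<and> j = 2 \<and>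
     (wx - c = 2 \<and> rx - c = 1 \<or> wx - c = - 2 \<and> rx - c = - 1)"
| "holds Second e m n k wx i rx j c y \<longleftrightarrow> 2 \<le> k \<and> inner m c \<and> y = 1 \<and> i \<ge> 5 \<and> k \<le> i"
| "holds Second_far e m n k wx i rx j c y \<longleftrightarrow> inner m c \<and> y = 1 \<and> i \<ge> 5 \<and> k = i + 1 \<and> \<not> e"
| "holds Second4a e m n k wx i rx j c y \<longleftrightarrow> 2 \<le> k \<and> inner m c \<and> y = 1 \<and> i = 4 \<and> k \<le> 5 \<and> j = 2 \<and> uncut m rx c"
| "holds Second4b e m n k wx i rx j c y \<longleftrightarrow> 2 \<le> k \<and> inner m c \<and> y = 1 \<and> i = 4 \<and> k \<le> 5 \<and> j = 0"
| "holds Second3a e m n k wx i rx j c y \<longleftrightarrow> 2 \<le> k \<and> inner m c \<and> y = 1 \<and> i = 3 \<and> k \<le> 4 \<and> wx \<noteq> c \<and>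
     (c = 2 \<and> rx = c + 1 \<longrightarrow> wx \<ge> c + 2) \<and> (c = m - 1 \<and> rx = c - 1 \<longrightarrow> wx \<le> c - 2)"
| "holds Second3b e m n k wx i rx j c y \<longleftrightarrow> 2 \<le> k \<and> inner m c \<and> y = 1 \<and> i = 3 \<and> k \<le> 4 \<and> (j = 0 \<or> j = 2) \<and> uncut m rx c"
| "holds Fourth e m n k wx i rx j c y \<longleftrightarrow> 2 \<le> k \<and> inner m c \<and> y = 3 \<and> i = 3 \<and> j = 1 \<and> k \<le> 4 \<and> n \<ge> 6"
| "holds Third e m n k wx i rx j c y \<longleftrightarrow> 2 \<le> k \<and> inner m c \<and> y = 2 \<and> i \<ge> 3 \<and> k \<le> i"
| "holds Third_far e m n k wx i rx j c y \<longleftrightarrow> inner m c \<and> y = 2 \<and> i \<ge> 4 \<and> k = i + 1 \<and> e"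
| "holds Third_cut e m n k wx i rx j c y \<longleftrightarrow> inner m c \<and> y = 2 \<and> i \<ge> 4 \<and> k = i + 1 \<and> j = 1"
| "holds Side e m n k wx i rx j c y \<longleftrightarrow> 2 \<le> k \<and> rim m c \<and> i \<ge> 5 \<and> 0 \<le> y \<and> y \<le> 2 \<and> k \<le> i - 1"
| "holds Side41 e m n k wx i rx j c y \<longleftrightarrow> 2 \<le> k \<and> rim m c \<and> i = 4 \<and> y = 1 \<and> k \<le> 3"
| "holds Side41_open e m n k wx i rx j c y \<longleftrightarrow> 2 \<le> k \<and> rim m c \<and> i = 4 \<and> y = 1 \<and> k \<le> 4 \<and> \<not> fenced m rx c"
| "holds Side31a e m n k wx i rx j c y \<longleftrightarrow> 2 \<le> k \<and> rim m c \<and> i = 3 \<and> y = 1 \<and> k \<le> 3 \<and> wx = c"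
| "holds Side31b e m n k wx i rx j c y \<longleftrightarrow> 2 \<le> k \<and> rim m c \<and> i = 3 \<and> y = 1 \<and> k \<le> 3 \<and> j = 2 \<and> near wx c 2 \<and> near rx c 2"
| "holds Side32 e m n k wx i rx j c y \<longleftrightarrow> 2 \<le> k \<and> rim m c \<and> i = 3 \<and> y = 2 \<and> k \<le> 3 \<and>
     (wx - c = 3 \<or> wx - c = - 3) \<and> fenced m rx c"
| "holds Side_opp e m n k wx i rx j c y \<longleftrightarrow> 2 \<le> k \<and> c = m \<and> wx = m \<and> rx = m - 1 \<and> i \<le> j \<and> i \<ge> 3 \<and> k \<le> i \<and>
     (y = 0 \<and> e \<or> y = 1 \<and> \<not> e)"
| "holds Side40 e m n k wx i rx j c y \<longleftrightarrow> 2 \<le> k \<and> rim m c \<and> i = 4 \<and> y = 0 \<and> k \<le> 3 \<and> j \<noteq> 1"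

section \<open>Closure of the family under play\<close>

text \<open>Here \<open>k\<close> counts White's moves before the move just made. For
  \<open>k = 1\<close> no further White move remains, so any legal reply is good enough. The list
  \<open>S\<close> restricts the shapes that have to be tried.\<close>

definition answer :: "shape list \<Rightarrow> bool \<Rightarrow> int \<Rightarrow> int \<Rightarrow> int \<Rightarrow> int \<Rightarrow> int \<Rightarrow> int \<Rightarrow> int \<Rightarrow> int \<Rightarrow> int \<Rightarrow> bool" where
  "answer S e m n k wx i rx j a b \<longleftrightarrow> takes wx i rx j a b \<or>
     reply m n wx i rx j a b \<and> (k = 1 \<or> (\<exists>s\<in>set S. holds s e m n (k - 1) wx i rx j a b))"

lemma bex_list: "(\<exists>s\<in>set []. P s) \<longleftrightarrow> False" "(\<exists>s\<in>set (t # S). P s) \<longleftrightarrow> P t \<or> (\<exists>s\<in>set S. P s)"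
  by auto

text \<open>The closure conditions use only the parity \<open>e\<close> of a few small row indices, which are listed here so
  that divisibility stays out of the arithmetic.\<close>

definition before :: "bool \<Rightarrow> int \<Rightarrow> int \<Rightarrow> int \<Rightarrow> int \<Rightarrow> int \<Rightarrow> int \<Rightarrow> int \<Rightarrow> int \<Rightarrow> int \<Rightarrow> bool" where
  "before e m n k wx i rx j c y \<longleftrightarrow> m \<ge> 4 \<and> n \<ge> 5 \<and> k \<ge> 1 \<and> (k \<ge> 5 \<longrightarrow> n \<ge> 6) \<and>
     placed m n wx i rx j c y \<and> \<not> att rx j wx i c y \<and>
     (i = 3 \<longrightarrow> \<not> e) \<and> (i = 4 \<longrightarrow> e) \<and> (i = 5 \<longrightarrow> \<not> e) \<and> (i = 6 \<longrightarrow> e)"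

text \<open>The last conjunct leaves out two outcomes: stalemate, which already fails White, and the
  case that Black is not in check and can only capture. Both are treated in
  \<open>held_step\<close>.\<close>

definition king_step where
  "king_step e e' m n k wx i vx vi rx j c y \<longleftrightarrow> before e m n k wx i rx j c y \<and>
     in_box wx i vx vi 1 \<and> \<not> (wx = vx \<and> i = vi) \<and> placed m n vx vi rx j c y \<and> (e' \<longleftrightarrow> (if vi = i then e else \<not> e)) \<and>
     (att rx j vx vi c y \<or> go (reply m n vx vi rx j) c y)"

definition rook_step where
  "rook_step e m n k wx i rx j sx sj c y \<longleftrightarrow> before e m n k wx i rx j c y \<and>
     (rx = sx \<or> j = sj) \<and> \<not> (rx = sx \<and> j = sj) \<and> placed m n wx i sx sj c y \<and>
     (att sx sj wx i c y \<or> go (reply m n wx i sx sj) c y)"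

lemmas pos_defs = near_def in_box_def betw_def att_def board_def placed_def reply_def takes_def go_def
  inside_def corner_def edge1_def edge2_def inner_def rim_def room_def uncut_def fenced_def
  before_def answer_def holds.simps bex_list

declare [[smt_timeout = 300]]

text \<open>For each shape the claim unfolds to a quantifier-free statement of linear integer
  arithmetic. The list in each case names the shapes into which Black replies. Since an answer
  exists even when White gives check, no such move mates.\<close>

lemma king_step_answer:
  assumes "holds s e m n k wx i rx j c y" "king_step e e' m n k wx i vx vi rx j c y"
  shows "\<exists>S. go (answer S e' m n k vx vi rx j) c y"
proof (cases s)
  case Start
  \<comment> \<open>\<open>Top_six\<close> serves the board with six rows: there the king has
    advanced to index 4, which is too close for \<open>Top_far\<close>.\<close>
  from assms have "go (answer [Inside, Second, Top_far, Top_six] e' m n k vx vi rx j) c y"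
    unfolding Start king_step_def pos_defs by (smt (z3))
  then show ?thesis ..
next
  case Inside
  \<comment> \<open>Splitting on \<open>k\<close> leaves a single target shape for each budget. It
    also covers replies off the edges, where \<open>Edge1\<close> and \<open>Edge2\<close> hold
    vacuously.\<close>
  from assms consider "k = 1" | "k = 2" | "k = 3"
    unfolding Inside king_step_def before_def holds.simps by linarith
  then show ?thesis
  proof cases
    case 1
    with assms have "go (answer [] e' m n k vx vi rx j) c y"
      unfolding Inside king_step_def pos_defs by (smt (z3))
    then show ?thesis ..
  next
    case 2
    with assms have "go (answer [Edge1] e' m n k vx vi rx j) c y"
      unfolding Inside king_step_def pos_defs by (smt (z3))
    then show ?thesis ..
  next
    case 3
    with assms have "go (answer [Edge2] e' m n k vx vi rx j) c y"
      unfolding Inside king_step_def pos_defs by (smt (z3))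
    then show ?thesis ..
  qed
next
  case Corner1
  from assms have "go (answer [] e' m n k vx vi rx j) c y"
    unfolding Corner1 king_step_def pos_defs by (smt (z3))
  then show ?thesis ..
next
  case Edge1
  from assms have "go (answer [] e' m n k vx vi rx j) c y"
    unfolding Edge1 king_step_def pos_defs by (smt (z3))
  then show ?thesis ..
next
  case Edge2
  from assms have "go (answer [Corner1, Edge1] e' m n k vx vi rx j) c y"
    unfolding Edge2 king_step_def pos_defs by (smt (z3))
  then show ?thesis ..
next
  case Corner2
  from assms have "go (answer [Edge1] e' m n k vx vi rx j) c y"
    unfolding Corner2 king_step_def pos_defs by (smt (z3))
  then show ?thesis ..
next
  case Top
  from assms have "go (answer [Inside, Edge1, Top, Cut5, Cut3, Second] e' m n k vx vi rx j) c y"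
    unfolding Top king_step_def pos_defs by (smt (z3))
  then show ?thesis ..
next
  case Top_far
  from assms have "go (answer [Cut5, Second, Second_far] e' m n k vx vi rx j) c y"
    unfolding Top_far king_step_def pos_defs by (smt (z3))
  then show ?thesis ..
next
  case Top_six
  from assms have "go (answer [Inside, Top, Second, Second3a] e' m n k vx vi rx j) c y"
    unfolding Top_six king_step_def pos_defs by (smt (z3))
  then show ?thesis ..
next
  case Cut5
  from assms have "go (answer [Edge1, Cut5, Cut4] e' m n k vx vi rx j) c y"
    unfolding Cut5 king_step_def pos_defs by (smt (z3))
  then show ?thesis ..
next
  case Cut4
  from assms have "go (answer [Edge1, Top, Cut5, Cut3_wide] e' m n k vx vi rx j) c y"
    unfolding Cut4 king_step_def pos_defs by (smt (z3))
  then show ?thesis ..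
next
  case Cut3
  from assms have "go (answer [Edge1, Edge2] e' m n k vx vi rx j) c y"
    unfolding Cut3 king_step_def pos_defs by (smt (z3))
  then show ?thesis ..
next
  case Cut3_wide
  from assms have "go (answer [Edge1, Top, Cut3, Cut2] e' m n k vx vi rx j) c y"
    unfolding Cut3_wide king_step_def pos_defs by (smt (z3))
  then show ?thesis ..
next
  case Cut2
  from assms have "go (answer [Edge1, Edge2] e' m n k vx vi rx j) c y"
    unfolding Cut2 king_step_def pos_defs by (smt (z3))
  then show ?thesis ..
next
  case Top_box
  from assms have "go (answer [Inside] e' m n k vx vi rx j) c y"
    unfolding Top_box king_step_def pos_defs by (smt (z3))
  then show ?thesis ..
next
  case Second
  from assms have "go (answer [Inside, Top, Second, Third] e' m n k vx vi rx j) c y"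
    unfolding Second king_step_def pos_defs by (smt (z3))
  then show ?thesis ..
next
  case Second_far
  from assms have "go (answer [Top_far, Second, Second4a, Third, Third_far] e' m n k vx vi rx j) c y"
    unfolding Second_far king_step_def pos_defs by (smt (z3))
  then show ?thesis ..
next
  case Second4a
  from assms have "go (answer [Inside, Top, Second, Second3b] e' m n k vx vi rx j) c y"
    unfolding Second4a king_step_def pos_defs by (smt (z3))
  then show ?thesis ..
next
  case Second4b
  from assms have "go (answer [Inside, Second, Second4b, Second3b] e' m n k vx vi rx j) c y"
    unfolding Second4b king_step_def pos_defs by (smt (z3))
  then show ?thesis ..
next
  case Second3a
  from assms have "go (answer [Inside, Edge1, Top_box, Side31b] e' m n k vx vi rx j) c y"
    unfolding Second3a king_step_def pos_defs by (smt (z3))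
  then show ?thesis ..
next
  case Second3b
  from assms have "go (answer [Inside] e' m n k vx vi rx j) c y"
    unfolding Second3b king_step_def pos_defs by (smt (z3))
  then show ?thesis ..
next
  case Fourth
  from assms have "go (answer [Inside] e' m n k vx vi rx j) c y"
    unfolding Fourth king_step_def pos_defs by (smt (z3))
  then show ?thesis ..
next
  case Third
  from assms have "go (answer [Inside, Second, Third, Side41_open] e' m n k vx vi rx j) c y"
    unfolding Third king_step_def pos_defs by (smt (z3))
  then show ?thesis ..
next
  case Third_far
  from assms have "go (answer [Second, Second_far, Second3a, Fourth, Third, Third_cut, Side41_open] e' m n k vx vi rx j) c y"
    unfolding Third_far king_step_def pos_defs by (smt (z3))
  then show ?thesis ..
next
  case Third_cut
  from assms have "go (answer [Fourth, Third, Third_cut] e' m n k vx vi rx j) c y"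
    unfolding Third_cut king_step_def pos_defs by (smt (z3))
  then show ?thesis ..
next
  case Side
  from assms have "go (answer [Edge1, Top, Cut5, Second, Third, Side, Side41, Side40] e' m n k vx vi rx j) c y"
    unfolding Side king_step_def pos_defs by (smt (z3))
  then show ?thesis ..
next
  case Side41
  from assms have "go (answer [Inside, Corner1, Edge2, Corner2, Side32] e' m n k vx vi rx j) c y"
    unfolding Side41 king_step_def pos_defs by (smt (z3))
  then show ?thesis ..
next
  case Side41_open
  from assms have "go (answer [Inside] e' m n k vx vi rx j) c y"
    unfolding Side41_open king_step_def pos_defs by (smt (z3))
  then show ?thesis ..
next
  case Side31a
  from assms have "go (answer [Inside, Corner1, Edge2, Corner2] e' m n k vx vi rx j) c y"
    unfolding Side31a king_step_def pos_defs by (smt (z3))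
  then show ?thesis ..
next
  case Side31b
  from assms have "go (answer [Inside, Corner1, Corner2] e' m n k vx vi rx j) c y"
    unfolding Side31b king_step_def pos_defs by (smt (z3))
  then show ?thesis ..
next
  case Side32
  from assms have "go (answer [Edge1, Edge2] e' m n k vx vi rx j) c y"
    unfolding Side32 king_step_def pos_defs by (smt (z3))
  then show ?thesis ..
next
  case Side_opp
  from assms have "go (answer [Inside, Edge1, Top, Second, Side, Side_opp, Side40] e' m n k vx vi rx j) c y"
    unfolding Side_opp king_step_def pos_defs by (smt (z3))
  then show ?thesis ..
next
  case Side40
  from assms have "go (answer [Edge1, Edge2] e' m n k vx vi rx j) c y"
    unfolding Side40 king_step_def pos_defs by (smt (z3))
  then show ?thesis ..
qed

text \<open>The same closure argument for rook moves; the White king stands still, so the parity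
  \<open>e\<close> is unchanged.\<close>

lemma rook_step_answer:
  assumes "holds s e m n k wx i rx j c y" "rook_step e m n k wx i rx j sx sj c y"
  shows "\<exists>S. go (answer S e m n k wx i sx sj) c y"
proof (cases s)
  case Start
  \<comment> \<open>The critical move is the rook to column \<open>m - 1\<close>, after which Black
    must step down to row index 1. This leads to \<open>Side_opp\<close> for even \<open>n\<close>,
    to \<open>Side41\<close> for \<open>n = 5\<close> and to \<open>Side\<close> for larger odd
    \<open>n\<close>.\<close>
  from assms have "go (answer [Top, Side, Side41, Cut5, Second, Side_opp] e m n k wx i sx sj) c y"
    unfolding Start rook_step_def pos_defs by (smt (z3))
  then show ?thesis ..
next
  case Inside
  from assms have "go (answer [Edge1, Edge2] e m n k wx i sx sj) c y"
    unfolding Inside rook_step_def pos_defs by (smt (z3))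
  then show ?thesis ..
next
  case Corner1
  from assms have "go (answer [] e m n k wx i sx sj) c y"
    unfolding Corner1 rook_step_def pos_defs by (smt (z3))
  then show ?thesis ..
next
  case Edge1
  from assms have "go (answer [] e m n k wx i sx sj) c y"
    unfolding Edge1 rook_step_def pos_defs by (smt (z3))
  then show ?thesis ..
next
  case Edge2
  from assms have "go (answer [Corner1, Edge1] e m n k wx i sx sj) c y"
    unfolding Edge2 rook_step_def pos_defs by (smt (z3))
  then show ?thesis ..
next
  case Corner2
  from assms have "go (answer [Edge1] e m n k wx i sx sj) c y"
    unfolding Corner2 rook_step_def pos_defs by (smt (z3))
  then show ?thesis ..
next
  case Top
  from assms have "go (answer [Inside, Edge1, Top, Second] e m n k wx i sx sj) c y"
    unfolding Top rook_step_def pos_defs by (smt (z3))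
  then show ?thesis ..
next
  case Top_far
  from assms have "go (answer [Top, Second] e m n k wx i sx sj) c y"
    unfolding Top_far rook_step_def pos_defs by (smt (z3))
  then show ?thesis ..
next
  case Top_six
  from assms have "go (answer [Edge1, Top, Side41_open] e m n k wx i sx sj) c y"
    unfolding Top_six rook_step_def pos_defs by (smt (z3))
  then show ?thesis ..
next
  case Cut5
  from assms have "go (answer [Edge1, Cut5, Second] e m n k wx i sx sj) c y"
    unfolding Cut5 rook_step_def pos_defs by (smt (z3))
  then show ?thesis ..
next
  case Cut4
  from assms have "go (answer [Edge1, Top, Second4b] e m n k wx i sx sj) c y"
    unfolding Cut4 rook_step_def pos_defs by (smt (z3))
  then show ?thesis ..
next
  case Cut3
  from assms have "go (answer [Inside, Edge1, Cut3] e m n k wx i sx sj) c y"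
    unfolding Cut3 rook_step_def pos_defs by (smt (z3))
  then show ?thesis ..
next
  case Cut3_wide
  from assms have "go (answer [Inside, Edge1, Cut3] e m n k wx i sx sj) c y"
    unfolding Cut3_wide rook_step_def pos_defs by (smt (z3))
  then show ?thesis ..
next
  case Cut2
  from assms have "go (answer [Corner1, Edge1, Edge2, Corner2] e m n k wx i sx sj) c y"
    unfolding Cut2 rook_step_def pos_defs by (smt (z3))
  then show ?thesis ..
next
  case Top_box
  from assms have "go (answer [Corner1, Edge1, Edge2, Corner2] e m n k wx i sx sj) c y"
    unfolding Top_box rook_step_def pos_defs by (smt (z3))
  then show ?thesis ..
next
  case Second
  from assms have "go (answer [Inside, Second, Third] e m n k wx i sx sj) c y"
    unfolding Second rook_step_def pos_defs by (smt (z3))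
  then show ?thesis ..
next
  case Second_far
  from assms have "go (answer [Second, Third] e m n k wx i sx sj) c y"
    unfolding Second_far rook_step_def pos_defs by (smt (z3))
  then show ?thesis ..
next
  case Second4a
  from assms have "go (answer [Inside, Top, Second4b] e m n k wx i sx sj) c y"
    unfolding Second4a rook_step_def pos_defs by (smt (z3))
  then show ?thesis ..
next
  case Second4b
  from assms have "go (answer [Inside, Top, Second4b] e m n k wx i sx sj) c y"
    unfolding Second4b rook_step_def pos_defs by (smt (z3))
  then show ?thesis ..
next
  case Second3a
  from assms have "go (answer [Inside, Edge1, Cut3, Top_box, Side31a, Side31b] e m n k wx i sx sj) c y"
    unfolding Second3a rook_step_def pos_defs by (smt (z3))
  then show ?thesis ..
next
  case Second3b
  from assms have "go (answer [Inside, Edge1, Cut3, Top_box, Side31b] e m n k wx i sx sj) c y"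
    unfolding Second3b rook_step_def pos_defs by (smt (z3))
  then show ?thesis ..
next
  case Fourth
  from assms have "go (answer [Inside, Edge1, Side32] e m n k wx i sx sj) c y"
    unfolding Fourth rook_step_def pos_defs by (smt (z3))
  then show ?thesis ..
next
  case Third
  from assms have "go (answer [Inside, Second, Third] e m n k wx i sx sj) c y"
    unfolding Third rook_step_def pos_defs by (smt (z3))
  then show ?thesis ..
next
  case Third_far
  from assms have "go (answer [Second, Second4a, Third, Side41_open] e m n k wx i sx sj) c y"
    unfolding Third_far rook_step_def pos_defs by (smt (z3))
  then show ?thesis ..
next
  case Third_cut
  from assms have "go (answer [Second, Second4a, Third, Side41_open] e m n k wx i sx sj) c y"
    unfolding Third_cut rook_step_def pos_defs by (smt (z3))
  then show ?thesis ..
next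
  case Side
  from assms have "go (answer [Edge1, Cut5, Second, Third, Side] e m n k wx i sx sj) c y"
    unfolding Side rook_step_def pos_defs by (smt (z3))
  then show ?thesis ..
next
  case Side41
  from assms have "go (answer [Edge1, Edge2] e m n k wx i sx sj) c y"
    unfolding Side41 rook_step_def pos_defs by (smt (z3))
  then show ?thesis ..
next
  case Side41_open
  from assms have "go (answer [Inside, Edge1, Side40] e m n k wx i sx sj) c y"
    unfolding Side41_open rook_step_def pos_defs by (smt (z3))
  then show ?thesis ..
next
  case Side31a
  from assms have "go (answer [Inside, Corner1, Edge2, Corner2] e m n k wx i sx sj) c y"
    unfolding Side31a rook_step_def pos_defs by (smt (z3))
  then show ?thesis ..
next
  case Side31b
  from assms have "go (answer [Inside, Corner1, Corner2] e m n k wx i sx sj) c y"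
    unfolding Side31b rook_step_def pos_defs by (smt (z3))
  then show ?thesis ..
next
  case Side32
  from assms have "go (answer [Edge1, Edge2] e m n k wx i sx sj) c y"
    unfolding Side32 rook_step_def pos_defs by (smt (z3))
  then show ?thesis ..
next
  case Side_opp
  from assms have "go (answer [Inside, Corner1, Edge1, Corner2, Side, Side41] e m n k wx i sx sj) c y"
    unfolding Side_opp rook_step_def pos_defs by (smt (z3))
  then show ?thesis ..
next
  case Side40
  from assms have "go (answer [Edge1, Edge2] e m n k wx i sx sj) c y"
    unfolding Side40 rook_step_def pos_defs by (smt (z3))
  then show ?thesis ..
qed

section \<open>The lower bound\<close>

definition held :: "nat \<Rightarrow> nat \<Rightarrow> nat \<Rightarrow> pos \<Rightarrow> bool" where
  "held m n k p \<longleftrightarrow> (\<exists>s wx i rx j c y. p = pos_at n wx i rx j c y \<and> placed (int m) (int n) wx i rx j c y \<and>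
     \<not> att rx j wx i c y \<and> holds s (even i) (int m) (int n) (int k) wx i rx j c y)"

text \<open>Turns an arithmetical answer into an actual Black move. After a non-capturing reply
  Black is not in check, as \<open>held\<close> demands.\<close>

lemma go_black_moves:
  assumes "go (answer S e (int m) (int n) (int (Suc k)) wx i rx j) c y" "placed (int m) (int n) wx i rx j c y"
    "e = even i"
  shows "\<exists>p''\<in>black_moves m n (pos_at n wx i rx j c y). k = 0 \<or> fst (snd p'') = None \<or> held m n k p''"
proof -
  from assms(1) obtain a b where ab: "in_box a b c y 1" "\<not> (a = c \<and> b = y)"
    and ans: "answer S e (int m) (int n) (int (Suc k)) wx i rx j a b"
    unfolding go_iff by blast
  from ans consider "takes wx i rx j a b"
    | "reply (int m) (int n) wx i rx j a b" "k = 0 \<or> (\<exists>s. holds s e (int m) (int n) (int k) wx i rx j a b)"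
    unfolding answer_def by auto
  then show ?thesis
  proof cases
    case 1
    then have "board (int m) (int n) a b" using assms(2) by (simp add: takes_def placed_def)
    from black_capture [OF 1 this ab] show ?thesis by (intro bexI [rotated]) auto
  next
    case 2
    have "placed (int m) (int n) wx i rx j a b \<and> \<not> att rx j wx i a b"
      using 2(1) assms(2) unfolding reply_def placed_def in_box_def near_def by auto
    with 2 assms(3) black_step [OF 2(1) ab] show ?thesis
      unfolding held_def by (intro bexI [rotated]) blast+
  qed
qed

text \<open>If White's move gives check or leaves a non-capturing reply, the closure lemmas apply.
  Otherwise Black either can only capture, and does so, or is stalemated, which is not checkmate.
  The guard \<open>Suc k \<ge> 5 \<longrightarrow> n \<ge> 6\<close> supplies the corresponding
  condition in \<open>before\<close>.\<close>

lemma held_step: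
  assumes "held m n (Suc k) p" "p' \<in> white_moves m n p" "m \<ge> 4" "n \<ge> 5" "Suc k \<ge> 5 \<longrightarrow> n \<ge> 6"
  shows "\<not> checkmated m n p'"
    and "black_moves m n p' \<noteq> {} \<Longrightarrow>
      \<exists>p''\<in>black_moves m n p'. k = 0 \<or> fst (snd p'') = None \<or> held m n k p''"
proof -
  from assms(1) obtain s wx i rx j c y where p: "p = pos_at n wx i rx j c y"
    and pl: "placed (int m) (int n) wx i rx j c y" and na: "\<not> att rx j wx i c y"
    and h: "holds s (even i) (int m) (int n) (int (Suc k)) wx i rx j c y"
    unfolding held_def by blast
  have bef: "before (even i) (int m) (int n) (int (Suc k)) wx i rx j c y"
    using assms(3-5) pl na unfolding before_def by auto
  \<comment> \<open>One fact serves both claims: a checkmated Black king would be in check, and the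
    reply obtained here would contradict the mate.\<close>
  have *: "\<exists>p''\<in>black_moves m n p'. k = 0 \<or> fst (snd p'') = None \<or> held m n k p''"
    if ne: "black_in_check p' \<or> black_moves m n p' \<noteq> {}"
  proof -
    have go: "(\<exists>a b. in_box a b c y 1 \<and> \<not> (a = c \<and> b = y) \<and> takes vx vi qx qj a b) \<or>
        att qx qj vx vi c y \<or> go (reply (int m) (int n) vx vi qx qj) c y"
      if p': "p' = pos_at n vx vi qx qj c y" for vx vi qx qj
    proof (cases "black_in_check p'")
      case True
      then show ?thesis by (simp add: p' black_in_check_iff)
    next
      case False
      with ne obtain p'' where "p'' \<in> black_moves m n (pos_at n vx vi qx qj c y)" by (auto simp: p')
      then show ?thesis
        by (cases rule: black_moves_cases) (unfold go_iff, blast+)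
    qed
    have capt: ?thesis if "p' = pos_at n vx vi qx qj c y" "placed (int m) (int n) vx vi qx qj c y"
      "in_box a b c y 1" "\<not> (a = c \<and> b = y)" "takes vx vi qx qj a b" for vx vi qx qj a b
    proof -
      have "board (int m) (int n) a b" using that by (simp add: takes_def placed_def)
      from black_capture [OF that(5) this that(3,4)] show ?thesis
        unfolding that(1) by (intro bexI [rotated]) auto
    qed
    from assms(2) [unfolded p] pl show ?thesis
    proof (cases rule: white_moves_cases)
      case (king vx vi)
      show ?thesis
      proof (cases "att rx j vx vi c y \<or> go (reply (int m) (int n) vx vi rx j) c y")
        case True
        have "even vi \<longleftrightarrow> (if vi = i then even i else \<not> even i)"
        proof (cases "vi = i")
          case False
          with king(2) have "vi = i + 1 \<or> vi = i - 1" by (auto simp: in_box_def near_def)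
          then show ?thesis by auto
        qed simp
        then have "king_step (even i) (even vi) (int m) (int n) (int (Suc k)) wx i vx vi rx j c y"
          using bef king True unfolding king_step_def by blast
        from king_step_answer [OF h this] obtain S where
          "go (answer S (even vi) (int m) (int n) (int (Suc k)) vx vi rx j) c y" ..
        from go_black_moves [OF this king(3) refl] show ?thesis unfolding king(1) .
      qed (use go [OF king(1)] capt [OF king(1,3)] in blast)
    next
      case (rook sx sj)
      show ?thesis
      proof (cases "att sx sj wx i c y \<or> go (reply (int m) (int n) wx i sx sj) c y")
        case True
        have "rook_step (even i) (int m) (int n) (int (Suc k)) wx i rx j sx sj c y"
          using bef rook True unfolding rook_step_def by blast
        from rook_step_answer [OF h this] obtain S where
          "go (answer S (even i) (int m) (int n) (int (Suc k)) wx i sx sj) c y" ..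
        from go_black_moves [OF this rook(4) refl] show ?thesis unfolding rook(1) .
      qed (use go [OF rook(1)] capt [OF rook(1,4)] in blast)
    qed
  qed
  show "\<not> checkmated m n p'"
    using * unfolding checkmated_def by blast
  show "\<exists>p''\<in>black_moves m n p'. k = 0 \<or> fst (snd p'') = None \<or> held m n k p''"
    if "black_moves m n p' \<noteq> {}"
    using * that by blast
qed

text \<open>A captured rook never returns, and the White king alone gives no check.\<close>

lemma no_mate_without_rook:
  assumes "fst (snd p) = None"
  shows "\<not> mate_within m n k p"
  using assms
proof (induction k arbitrary: p)
  case (Suc k)
  have none: "fst (snd q) = None" if "q \<in> white_moves m n p" for q
    using that Suc.prems by (auto simp: white_moves_def split: prod.splits)
  have none': "fst (snd q') = None" if "q' \<in> black_moves m n q" "fst (snd q) = None" for q q'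
    using that by (auto simp: black_moves_def split: prod.splits)
  have no_check: "\<not> black_in_check q" if "fst (snd q) = None" for q
    using that by (auto simp: black_in_check_def split: prod.splits)
  show ?case
  proof
    assume "mate_within m n (Suc k) p"
    then obtain p' where p': "p' \<in> white_moves m n p" and "checkmated m n p' \<or>
        black_moves m n p' \<noteq> {} \<and> (\<forall>p''\<in>black_moves m n p'. mate_within m n k p'')"
      unfolding mate_within.simps by blast
    then obtain p'' where "p'' \<in> black_moves m n p'" "mate_within m n k p''"
      using no_check [OF none [OF p']] unfolding checkmated_def by blast
    with Suc.IH [OF none' [OF _ none [OF p']]] show False by blast
  qed
qed simp

text \<open>Induction on the budget: unless stalemated, Black has a move after which White has no
  moves left, has no rook, or faces a held position with one move less.\<close>

lemma held_no_mate:
  assumes "held m n k p" "m \<ge> 4" "n \<ge> 5" "k \<ge> 5 \<longrightarrow> n \<ge> 6"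
  shows "\<not> mate_within m n k p"
  using assms
proof (induction k arbitrary: p)
  case (Suc k)
  have IH: "\<not> mate_within m n k p''" if "k = 0 \<or> fst (snd p'') = None \<or> held m n k p''" for p''
    using that
  proof (elim disjE)
    show "\<not> mate_within m n k p''" if "held m n k p''"
      using Suc.IH [OF that] Suc.prems(2-4) by simp
  qed (simp_all add: no_mate_without_rook)
  show ?case
  proof
    assume "mate_within m n (Suc k) p"
    then obtain p' where p': "p' \<in> white_moves m n p" and "checkmated m n p' \<or>
        black_moves m n p' \<noteq> {} \<and> (\<forall>p''\<in>black_moves m n p'. mate_within m n k p'')"
      unfolding mate_within.simps by blast
    with held_step [OF Suc.prems(1) p' Suc.prems(2-4)] IH show False by blast
  qed
qed simp

lemma start_pos_eq: "start_pos m n = pos_at n (int m) (int n - 1) 1 (int n - 1) (int m) 0"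
  by (simp add: start_pos_def pos_at_def)

lemma start_no_mate:
  assumes "m \<ge> 4" "n \<ge> 5"
  shows "\<not> mate_within m n (if odd n then n - 1 else n) (start_pos m n)"
proof (rule held_no_mate)
  let ?k = "if odd n then n - 1 else n"
  \<comment> \<open>The budget is one below the claimed value; the parity of \<open>n - 1\<close>,
    the row index of the White king, selects the matching alternative of
    \<open>Start\<close>.\<close>
  have "holds Start (even (int n - 1)) (int m) (int n) (int ?k) (int m) (int n - 1) 1 (int n - 1) (int m) 0"
    using assms by (auto simp: of_nat_diff)
  moreover have "placed (int m) (int n) (int m) (int n - 1) 1 (int n - 1) (int m) 0"
    "\<not> att 1 (int n - 1) (int m) (int n - 1) (int m) 0"
    using assms by (auto simp: placed_def board_def in_box_def near_def att_def betw_def)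
  ultimately show "held m n ?k (start_pos m n)"
    unfolding held_def start_pos_eq by blast
  \<comment> \<open>For \<open>n = 5\<close> the budget is 4, and even \<open>n\<close> are at least
    6, so the guard on \<open>k\<close> holds.\<close>
  have "n \<noteq> 5" if "even n" using that by auto
  then show "5 \<le> ?k \<longrightarrow> 6 \<le> n" using assms by (auto split: if_splits)
qed (use assms in auto)

section \<open>The upper bound\<close>

lemma mate_within_Suc: "mate_within m n k p \<Longrightarrow> mate_within m n (Suc k) p"
  by (induction k arbitrary: p) (simp, metis mate_within.simps(2))

lemma mate_within_mono:
  assumes "mate_within m n k p" "k \<le> l"
  shows "mate_within m n l p"
  using assms(2,1) by (induction rule: dec_induct) (auto intro: mate_within_Suc simp del: mate_within.simps)

text \<open>The single reply \<open>(a, b)\<close> shows that White's move does not stalemate; the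
  remaining premises say that the rook is safe and that every reply loses.\<close>

lemma mate_within_step:
  assumes "pos_at n vx vi rx j c y \<in> white_moves m n p"
    and "in_box a b c y 1" "\<not> (a = c \<and> b = y)" "reply (int m) (int n) vx vi rx j a b"
    and "\<And>a b. in_box a b c y 1 \<Longrightarrow> \<not> (a = c \<and> b = y) \<Longrightarrow> \<not> takes vx vi rx j a b"
    and "\<And>a b. in_box a b c y 1 \<Longrightarrow> \<not> (a = c \<and> b = y) \<Longrightarrow> reply (int m) (int n) vx vi rx j a b \<Longrightarrow>
      mate_within m n k (pos_at n vx vi rx j a b)"
  shows "mate_within m n (Suc k) p"
proof -
  have "mate_within m n k p''" if "p'' \<in> black_moves m n (pos_at n vx vi rx j c y)" for p''
    using that by (cases rule: black_moves_cases) (use assms(5,6) in blast)+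
  then show ?thesis
    using assms(1) black_step [OF assms(4,2,3)] by auto
qed

text \<open>A path free of both kings is split into two conditions \<open>att\<close>, each with one
  king as the only blocker.\<close>

lemma white_rook_move:
  assumes "board (int m) (int n) sx sj" "att rx j wx i sx sj" "att rx j c y sx sj"
    "\<not> (sx = wx \<and> sj = i)" "\<not> (sx = c \<and> sj = y)"
  shows "pos_at n wx i sx sj c y \<in> white_moves m n (pos_at n wx i rx j c y)"
proof -
  have "rook_attacks (rx, int n - j) {(wx, int n - i), (c, int n - y)} (sx, int n - sj)"
    using assms(2,3) unfolding rook_attacks_att [of rx "int n", symmetric] rook_attacks_def by auto
  with assms(1,4,5) show ?thesis
    unfolding white_moves_def pos_at_def by (auto simp: on_board_iff)
qed

section \<open>The mating line\<close>

text \<open>The White king goes to \<open>(m - 1, 2)\<close>, Black must leave the corner along the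
  top row, the rook goes to column \<open>m - 2\<close> and drives the Black king back, and the rook
  mates on the top row. The proof runs backwards from the mate.\<close>

lemma corner_mate:
  assumes "m \<ge> 4" "4 \<le> j" "j \<le> int n - 1"
  shows "mate_within m n 3 (pos_at n (int m) 3 (int m - 1) j (int m) 0)"
proof -
  define M where "M = int m"
  define N where "N = int n"
  have M: "M \<ge> 4" and j: "4 \<le> j" "j \<le> N - 1" using assms by (auto simp: M_def N_def)
  note defs = in_box_def near_def att_def betw_def board_def placed_def reply_def takes_def
  have mate: "mate_within m n 1 (pos_at n (M - 1) 2 (M - 2) j M 0)"
  proof -
    have "pos_at n (M - 1) 2 (M - 2) 0 M 0 \<in> white_moves m n (pos_at n (M - 1) 2 (M - 2) j M 0)"
      using M j by (intro white_rook_move) (auto simp: defs M_def [symmetric] N_def [symmetric])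
    moreover have "checkmated m n (pos_at n (M - 1) 2 (M - 2) 0 M 0)"
    proof -
      have "\<not> takes (M - 1) 2 (M - 2) 0 a b \<and> \<not> reply M N (M - 1) 2 (M - 2) 0 a b"
        if "in_box a b M 0 1" "\<not> (a = M \<and> b = 0)" for a b
        using that M unfolding defs by (smt (z3))
      then have "p'' \<notin> black_moves m n (pos_at n (M - 1) 2 (M - 2) 0 M 0)" for p''
        unfolding M_def N_def by (blast elim: black_moves_cases)
      moreover have "att (M - 2) 0 (M - 1) 2 M 0" using M by (auto simp: defs)
      ultimately show ?thesis
        unfolding checkmated_def black_in_check_iff by blast
    qed
    ultimately show ?thesis by auto
  qed
  have mate2: "mate_within m n (Suc 1) (pos_at n (M - 1) 2 (M - 1) j (M - 1) 0)"
  proof (rule mate_within_step [where vx = "M - 1" and vi = 2 and rx = "M - 2" and j = j and c = "M - 1" and y = 0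
        and a = M and b = 0])
    show "pos_at n (M - 1) 2 (M - 2) j (M - 1) 0 \<in> white_moves m n (pos_at n (M - 1) 2 (M - 1) j (M - 1) 0)"
      using M j by (intro white_rook_move) (auto simp: defs M_def [symmetric] N_def [symmetric])
    show "reply (int m) (int n) (M - 1) 2 (M - 2) j M 0"
      using M j unfolding M_def [symmetric] N_def [symmetric] defs by (smt (z3))
    fix a b assume ab: "in_box a b (M - 1) 0 1" "\<not> (a = M - 1 \<and> b = 0)"
    show "\<not> takes (M - 1) 2 (M - 2) j a b"
      using ab M j unfolding defs by (smt (z3))
    assume "reply (int m) (int n) (M - 1) 2 (M - 2) j a b"
    then have "a = M \<and> b = 0"
      using ab M j unfolding M_def [symmetric] N_def [symmetric] defs by (smt (z3))
    then show "mate_within m n 1 (pos_at n (M - 1) 2 (M - 2) j a b)" using mate by simp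
  qed (use M in \<open>auto simp: defs\<close>)
  \<comment> \<open>In front of its rook the White king shields \<open>(M - 1, 0)\<close>, so Black
    has exactly this move and is not stalemated.\<close>
  have "mate_within m n (Suc (Suc 1)) (pos_at n M 3 (M - 1) j M 0)"
  proof (rule mate_within_step [where vx = "M - 1" and vi = 2 and rx = "M - 1" and j = j and c = M and y = 0
        and a = "M - 1" and b = 0])
    show "pos_at n (M - 1) 2 (M - 1) j M 0 \<in> white_moves m n (pos_at n M 3 (M - 1) j M 0)"
      using M j by (intro white_king_move) (auto simp: defs M_def [symmetric] N_def [symmetric])
    show "reply (int m) (int n) (M - 1) 2 (M - 1) j (M - 1) 0"
      using M j unfolding M_def [symmetric] N_def [symmetric] defs by (smt (z3))
    fix a b assume ab: "in_box a b M 0 1" "\<not> (a = M \<and> b = 0)"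
    show "\<not> takes (M - 1) 2 (M - 1) j a b"
      using ab M j unfolding defs by (smt (z3))
    assume "reply (int m) (int n) (M - 1) 2 (M - 1) j a b"
    then have "a = M - 1 \<and> b = 0"
      using ab M j unfolding M_def [symmetric] N_def [symmetric] defs by (smt (z3))
    then show "mate_within m n (Suc 1) (pos_at n (M - 1) 2 (M - 1) j a b)" using mate2 by simp
  qed (use M in \<open>auto simp: defs\<close>)
  then show ?thesis by (simp add: M_def eval_nat_numeral)
qed

text \<open>The rook confines the Black king to column \<open>m\<close>; with an odd row distance and White to move, the
  White king may simply walk up the same column.\<close>

lemma ladder_mate:
  assumes "m \<ge> 4" "3 \<le> k" "k < n" "0 \<le> y" "y + 3 \<le> int k" "odd (int k - y)" "4 \<le> j" "int k - 1 \<le> j" "j \<le> int n - 1"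
  shows "mate_within m n k (pos_at n (int m) (int k) (int m - 1) j (int m) y)"
  using assms(2-)
proof (induction k arbitrary: y rule: dec_induct)
  case base
  then have "y = 0" by auto
  with corner_mate [of m j n] base assms(1) show ?case by simp
next
  case (step k)
  define M where "M = int m"
  define N where "N = int n"
  define i where "i = int k"
  have M: "M \<ge> 4" and i: "3 \<le> i" "i + 1 < N" "int (Suc k) = i + 1"
    and y: "0 \<le> y" "y + 3 \<le> i + 1" and j: "4 \<le> j" "i \<le> j" "j \<le> N - 1"
    using assms(1) step by (auto simp: M_def N_def i_def)
  have par: "odd (i + 1 - y)" using step.prems by (simp add: i_def algebra_simps)
  then have y3: "y = 0 \<longrightarrow> i \<ge> 4" using i(1) by (cases "i = 3") auto
  \<comment> \<open>Legality of Black's reply gives only \<open>z + 2 \<le> i\<close>; as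
    \<open>i - z\<close> is odd, equality is impossible, and the bound required by the induction
    hypothesis follows.\<close>
  have IH: "mate_within m n k (pos_at n M i (M - 1) j M z)" if "z = y + 1 \<or> z = y - 1" "0 \<le> z" "z + 2 \<le> i" for z
  proof -
    have "odd (i - z)" using that(1) par by auto
    moreover from this that have "z + 3 \<le> i" by (cases "z + 2 = i") auto
    ultimately show ?thesis
      using step.IH [of z] step.prems that i j by (simp add: M_def N_def i_def)
  qed
  note defs = in_box_def near_def att_def betw_def board_def placed_def reply_def takes_def
  have "mate_within m n (Suc k) (pos_at n M (i + 1) (M - 1) j M y)"
  \<comment> \<open>The witness against stalemate is a step towards the top row, or down from it
    when \<open>y = 0\<close>.\<close>
  proof (rule mate_within_step [where vx = M and vi = i and rx = "M - 1" and j = j and c = M and y = y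
        and a = M and b = "if y = 0 then 1 else y - 1"])
    show "pos_at n M i (M - 1) j M y \<in> white_moves m n (pos_at n M (i + 1) (M - 1) j M y)"
      using M i j y by (intro white_king_move) (auto simp: defs M_def [symmetric] N_def [symmetric])
    show "reply (int m) (int n) M i (M - 1) j M (if y = 0 then 1 else y - 1)"
      using M i j y y3 unfolding M_def [symmetric] N_def [symmetric] defs by (smt (z3))
    fix a b assume ab: "in_box a b M y 1" "\<not> (a = M \<and> b = y)"
    show "\<not> takes M i (M - 1) j a b"
      using ab M i j y unfolding defs by (smt (z3))
    assume "reply (int m) (int n) M i (M - 1) j a b"
    then have "a = M \<and> (b = y + 1 \<or> b = y - 1) \<and> 0 \<le> b \<and> b + 2 \<le> i"
      using ab M i j y unfolding M_def [symmetric] N_def [symmetric] defs by (smt (z3))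
    then show "mate_within m n k (pos_at n M i (M - 1) j a b)" using IH by auto
  qed (auto simp: defs)
  then show ?case by (simp add: M_def i_def add.commute del: mate_within.simps)
qed

text \<open>The rook goes next to the White king and Black must step to row index 1. The row
  distance is then \<open>n - 2\<close>: for odd \<open>n\<close> the ladder starts at once, for
  even \<open>n\<close> one rook move in column \<open>m - 1\<close> first passes the turn.\<close>

lemma start_mate:
  assumes "m \<ge> 4" "n \<ge> 5"
  shows "mate_within m n (if odd n then n else n + 1) (start_pos m n)"
proof -
  define M where "M = int m"
  define N where "N = int n"
  have M: "M \<ge> 4" and N: "N \<ge> 5" using assms by (auto simp: M_def N_def)
  note defs = in_box_def near_def att_def betw_def board_def placed_def reply_def takes_def
  have second: "mate_within m n (if odd n then n - 1 else n) (pos_at n M (N - 1) (M - 1) (N - 1) M 1)"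
  proof (cases "odd n")
    case True
    then show ?thesis
      using ladder_mate [of m "n - 1" n 1 "N - 1"] assms by (auto simp: M_def N_def of_nat_diff)
  next
    case False
    \<comment> \<open>With \<open>n \<ge> 6\<close> the ladder admits the rook on index
      \<open>N - 2 \<ge> 4\<close> and a Black king on index 2.\<close>
    have n: "n \<ge> 6" using False assms(2) by (cases "n = 5") auto
    \<comment> \<open>After the waiting move Black is on index 0 or 2, at an odd distance from
      \<open>N - 1\<close>; the rook at \<open>N - 2\<close> is just at the bound
      \<open>int k - 1 \<le> j\<close> of \<open>ladder_mate\<close>.\<close>
    have IH: "mate_within m n (n - 1) (pos_at n M (N - 1) (M - 1) (N - 2) M z)" if "z = 0 \<or> z = 2" for z
      using that ladder_mate [of m "n - 1" n z "N - 2"] assms n False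
      by (auto simp: M_def N_def of_nat_diff)
    have "mate_within m n (Suc (n - 1)) (pos_at n M (N - 1) (M - 1) (N - 1) M 1)"
    proof (rule mate_within_step [where vx = M and vi = "N - 1" and rx = "M - 1" and j = "N - 2" and c = M and y = 1
          and a = M and b = 0])
      show "pos_at n M (N - 1) (M - 1) (N - 2) M 1 \<in> white_moves m n (pos_at n M (N - 1) (M - 1) (N - 1) M 1)"
        using M n by (intro white_rook_move) (auto simp: defs M_def N_def)
      have N6: "N \<ge> 6" using n by (simp add: N_def)
      show "reply (int m) (int n) M (N - 1) (M - 1) (N - 2) M 0"
        using M N6 unfolding M_def [symmetric] N_def [symmetric] defs by (smt (z3))
      fix a b assume ab: "in_box a b M 1 1" "\<not> (a = M \<and> b = 1)"
      show "\<not> takes M (N - 1) (M - 1) (N - 2) a b"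
        using ab M N6 unfolding defs by (smt (z3))
      assume "reply (int m) (int n) M (N - 1) (M - 1) (N - 2) a b"
      then have "a = M \<and> (b = 0 \<or> b = 2)"
        using ab M N6 unfolding M_def [symmetric] N_def [symmetric] defs by (smt (z3))
      then show "mate_within m n (n - 1) (pos_at n M (N - 1) (M - 1) (N - 2) a b)" using IH by auto
    qed (auto simp: defs)
    then show ?thesis using False n by simp
  qed
  have "mate_within m n (Suc (if odd n then n - 1 else n)) (pos_at n M (N - 1) 1 (N - 1) M 0)"
  proof (rule mate_within_step [where vx = M and vi = "N - 1" and rx = "M - 1" and j = "N - 1" and c = M and y = 0
        and a = M and b = 1])
    show "pos_at n M (N - 1) (M - 1) (N - 1) M 0 \<in> white_moves m n (pos_at n M (N - 1) 1 (N - 1) M 0)"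
      using M N by (intro white_rook_move) (auto simp: defs M_def N_def)
    show "reply (int m) (int n) M (N - 1) (M - 1) (N - 1) M 1"
      using M N unfolding M_def [symmetric] N_def [symmetric] defs by (smt (z3))
    fix a b assume ab: "in_box a b M 0 1" "\<not> (a = M \<and> b = 0)"
    show "\<not> takes M (N - 1) (M - 1) (N - 1) a b"
      using ab M N unfolding defs by (smt (z3))
    assume "reply (int m) (int n) M (N - 1) (M - 1) (N - 1) a b"
    then have "a = M \<and> b = 1"
      using ab M N unfolding M_def [symmetric] N_def [symmetric] defs by (smt (z3))
    then show "mate_within m n (if odd n then n - 1 else n) (pos_at n M (N - 1) (M - 1) (N - 1) a b)"
      using second by simp
  qed (auto simp: defs)
  moreover have "Suc (if odd n then n - 1 else n) = (if odd n then n else n + 1)" using assms by auto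
  ultimately show ?thesis by (simp only: start_pos_eq M_def N_def)
qed

section \<open>The exact value of \<open>FM\<close>\<close>

theorem mainTheorem1:
  fixes m n :: nat
  assumes "m \<ge> 4" and "n \<ge> 5"
  shows "(\<exists>k. mate_within m n k (start_pos m n)) \<and>
         FM m n = (if odd n then n else n + 1)"
proof
  let ?N = "if odd n then n else n + 1"
  have mate: "mate_within m n ?N (start_pos m n)" by (rule start_mate [OF assms])
  then show "\<exists>k. mate_within m n k (start_pos m n)" ..
  show "FM m n = ?N"
    unfolding FM_def
  proof (rule Least_equality)
    fix k assume k: "mate_within m n k (start_pos m n)"
    show "?N \<le> k"
    proof (rule ccontr)
      assume "\<not> ?N \<le> k"
      \<comment> \<open>A faster mate would by monotonicity also be one within the budget that
        \<open>start_no_mate\<close> refutes.\<close>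
      then have "k \<le> (if odd n then n - 1 else n)" by (auto split: if_splits)
      from mate_within_mono [OF k this] start_no_mate [OF assms] show False by blast
    qed
  qed (rule mate)
qed


end
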